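(* Assume that $(M,f)$ is a minimal isotropic surface in $\mathbb S^3_1(1)$, with $f=\frac12(\mu W(x,y)+\bar\mu\,\overline{W(x,y)})$ and $\mu=\dfrac{e^{i\theta}}{|x-y|}$, such that $\theta$ is a non-constant real valued harmonic function. Suppose in addition that $x$ and $y$ are holomorphic functions on $M$. Let $w_0\in M$. Then there exist constants $k,c\in\mathbb C\setminus\{0\}$ such that $$x(w)=\frac1c\int_{w_0}^w\big(1+ke^{\psi(\xi)}\big)\,d\xi,\qquad y(w)=\frac1{ck}\int_{w_0}^w\big(k+e^{-\psi(\xi)}\big)\,d\xi,$$ where the harmonic function $\psi$ is given by $$\psi(w)=\theta(w_0)-4i\int_{w_0}^w\theta_w(\xi)\,d\xi .$$
   Context: $\mathbb R^4_1$ is $\mathbb R^4$ with $\langle p,q\rangle=-p^1q^1+p^2q^2+p^3q^3+p^4q^4$, oriented by its canonical basis and time-oriented by the first basis vector; $\mathbb S^3_1(1)=\{p:\langle p,p\rangle=1\}$; $\langle\cdot,\cdot\rangle^{\mathbb C}$ is the complex bilinear extension to $\mathbb C^4$. $M\subset\mathbb C$ is open, connected and simply connected, with points $w=u+iv$; $\theta_w=\frac12(\theta_u-i\theta_v)$. "Harmonic" for the complex-valued $\psi$ means that its real and imaginary parts are harmonic. An isotropic surface $(M,f)$ of $\mathbb S^3_1(1)$ is a smooth $f:M\to\mathbb R^4_1$, a homeomorphism onto its image, with $\langle f,f\rangle=1$, $f_u,f_v$ linearly independent future directed lightlike vectors (induced metric $2F\,du\,dv$, $F=\langle f_u,f_v\rangle$).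 Its Gauss map is $\nu:M\to\mathbb S^3_1(1)$ with $\langle\nu,\nu\rangle=1$, $\langle\nu,f\rangle=\langle\nu,f_u\rangle=\langle\nu,f_v\rangle=0$ and $\{f,f_u,f_v,\nu\}$ positively oriented; it is assumed non-constant. Minimal means zero mean curvature in $\mathbb S^3_1(1)$, i.e. $\langle f_{uv},\nu\rangle=0$. For $x\neq y$ in $\mathbb C$: $L(x)=(1+x\bar x,x+\bar x,-i(x-\bar x),-1+x\bar x)$ and $W(x,y)=(1+x\bar y,x+\bar y,-i(x-\bar y),-1+x\bar y)$. Standing representation: $x,y,\mu:M\to\mathbb C$ and $\alpha,\beta:M\to\mathbb R$ are smooth, $x\ne y$ everywhere, $f_u=\alpha L(x)$, $f_v=\beta L(y)$, $|\mu|^2\langle W(x,y),\overline{W(x,y)}\rangle^{\mathbb C}=2$ (i.e. $|\mu|=1/|x-y|$), and $\nu=\frac1{2i}(\mu W(x,y)-\bar\mu\,\overline{W(x,y)})$.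
   Formalization: The formulas are stated with integration constants, x(w) = x(w_0) + (1/c)∫… and y(w) = y(w_0) + (1/(ck))∫…; taken literally, the English would give x(w_0) = y(w_0) = 0, contradicting x ≠ y on M. *)

theory Defs
  imports "HOL-Complex_Analysis.Complex_Analysis"
begin

text \<open>
  \<open>ck_on n S f\<close>: on the open set \<open>S\<close>, the map \<open>f\<close> is of class \<open>C^n\<close> in the real sense
  (all iterated directional derivatives up to order \<open>n\<close> exist, those below the top order are
  Frechet differentiable, and those of the top order are continuous).
\<close>

primrec ck_on :: "nat \<Rightarrow> 'a::real_normed_vector set \<Rightarrow> ('a \<Rightarrow> 'b::real_normed_vector) \<Rightarrow> bool" where
  "ck_on 0 S f \<longleftrightarrow> continuous_on S f"
| "ck_on (Suc n) S f \<longleftrightarrow>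
     (\<forall>p\<in>S. f differentiable (at p)) \<and> (\<forall>d. ck_on n S (\<lambda>p. frechet_derivative f (at p) d))"

definition smooth_on :: "'a::real_normed_vector set \<Rightarrow> ('a \<Rightarrow> 'b::real_normed_vector) \<Rightarrow> bool" where
  "smooth_on S f \<longleftrightarrow> (\<forall>n. ck_on n S f)"

text \<open>The coordinates are given by \<open>w = u + i v\<close>; \<open>dw\<close> is the Wirtinger derivative.\<close>

definition du :: "(complex \<Rightarrow> 'b::real_normed_vector) \<Rightarrow> complex \<Rightarrow> 'b" where
  "du f w = frechet_derivative f (at w) 1"

definition dv :: "(complex \<Rightarrow> 'b::real_normed_vector) \<Rightarrow> complex \<Rightarrow> 'b" where
  "dv f w = frechet_derivative f (at w) \<i>"

definition dw :: "(complex \<Rightarrow> real) \<Rightarrow> complex \<Rightarrow> complex" where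
  "dw g w = (1/2) * (of_real (du g w) - \<i> * of_real (dv g w))"

definition harmonic_on :: "complex set \<Rightarrow> (complex \<Rightarrow> real) \<Rightarrow> bool" where
  "harmonic_on M g \<longleftrightarrow> ck_on 2 M g \<and> (\<forall>w\<in>M. du (du g) w + dv (dv g) w = 0)"

definition complex_harmonic_on :: "complex set \<Rightarrow> (complex \<Rightarrow> complex) \<Rightarrow> bool" where
  "complex_harmonic_on M g \<longleftrightarrow>
     harmonic_on M (\<lambda>w. Re (g w)) \<and> harmonic_on M (\<lambda>w. Im (g w))"

text \<open>
  The integral from \<open>a\<close> to \<open>b\<close> in \<open>M\<close> is the contour integral along a path in \<open>paths_in M a b\<close>;
  assertions about it are made for every such path. It vanishes for \<open>a = b\<close>, so a function recovered
  by integrating its derivative from \<open>a\<close> carries its value at \<open>a\<close> as constant of integration.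
\<close>

definition paths_in :: "complex set \<Rightarrow> complex \<Rightarrow> complex \<Rightarrow> (real \<Rightarrow> complex) set" where
  "paths_in M a b =
     {\<gamma>. valid_path \<gamma> \<and> path_image \<gamma> \<subseteq> M \<and> pathstart \<gamma> = a \<and> pathfinish \<gamma> = b}"

text \<open>
  On \<open>real^4\<close> this is the Lorentz metric, on \<open>complex^4\<close> its complex bilinear extension.
\<close>

definition lor :: "'a::comm_ring_1 ^ 4 \<Rightarrow> 'a ^ 4 \<Rightarrow> 'a" where
  "lor p q = - (p$1 * q$1) + p$2 * q$2 + p$3 * q$3 + p$4 * q$4"

text \<open>
  For a causal vector, being in the time cone of the first basis vector means that its first
  coordinate is positive; a lightlike vector is nonzero by this condition.
\<close>

definition future_lightlike :: "real ^ 4 \<Rightarrow> bool" where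
  "future_lightlike p \<longleftrightarrow> lor p p = 0 \<and> p$1 > 0"

definition positively_oriented :: "real ^ 4 \<Rightarrow> real ^ 4 \<Rightarrow> real ^ 4 \<Rightarrow> real ^ 4 \<Rightarrow> bool" where
  "positively_oriented a b c d \<longleftrightarrow> det (vector [a, b, c, d] :: real ^ 4 ^ 4) > 0"

definition isotropic_surface :: "complex set \<Rightarrow> (complex \<Rightarrow> real ^ 4) \<Rightarrow> bool" where
  "isotropic_surface M f \<longleftrightarrow>
     open M \<and> connected M \<and> simply_connected M \<and>
     smooth_on M f \<and> (\<exists>g. homeomorphism M (f ` M) f g) \<and>
     (\<forall>w\<in>M. lor (f w) (f w) = 1 \<and>
        du f w \<noteq> dv f w \<and> independent {du f w, dv f w} \<and>
        future_lightlike (du f w) \<and> future_lightlike (dv f w))"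

definition gauss_map :: "complex set \<Rightarrow> (complex \<Rightarrow> real ^ 4) \<Rightarrow> (complex \<Rightarrow> real ^ 4) \<Rightarrow> bool" where
  "gauss_map M f \<nu> \<longleftrightarrow>
     (\<forall>w\<in>M. lor (\<nu> w) (\<nu> w) = 1 \<and> lor (\<nu> w) (f w) = 0 \<and>
        lor (\<nu> w) (du f w) = 0 \<and> lor (\<nu> w) (dv f w) = 0 \<and>
        positively_oriented (f w) (du f w) (dv f w) (\<nu> w))"

text \<open>
  In null coordinates, where the metric is \<open>2 F du dv\<close>, the mean curvature in the de Sitter space
  is the normal component of \<open>f_uv\<close> divided by \<open>F\<close>.
\<close>

definition minimal_surface :: "complex set \<Rightarrow> (complex \<Rightarrow> real ^ 4) \<Rightarrow> (complex \<Rightarrow> real ^ 4) \<Rightarrow> bool" where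
  "minimal_surface M f \<nu> \<longleftrightarrow> (\<forall>w\<in>M. lor (dv (du f) w) (\<nu> w) = 0)"

definition W :: "complex \<Rightarrow> complex \<Rightarrow> complex ^ 4" where
  "W x y = vector [1 + x * cnj y, x + cnj y, - \<i> * (x - cnj y), - 1 + x * cnj y]"

definition L :: "complex \<Rightarrow> complex ^ 4" where
  "L x = vector [1 + x * cnj x, x + cnj x, - \<i> * (x - cnj x), - 1 + x * cnj x]"

definition cvec :: "real ^ 4 \<Rightarrow> complex ^ 4" where
  "cvec p = (\<chi> i. complex_of_real (p $ i))"

definition cnj_vec :: "complex ^ 4 \<Rightarrow> complex ^ 4" where
  "cnj_vec p = (\<chi> i. cnj (p $ i))"

definition standing_representation ::
  "complex set \<Rightarrow> (complex \<Rightarrow> real ^ 4) \<Rightarrow> (complex \<Rightarrow> real ^ 4) \<Rightarrow>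
   (complex \<Rightarrow> complex) \<Rightarrow> (complex \<Rightarrow> complex) \<Rightarrow> (complex \<Rightarrow> complex) \<Rightarrow>
   (complex \<Rightarrow> real) \<Rightarrow> (complex \<Rightarrow> real) \<Rightarrow> bool" where
  "standing_representation M f \<nu> x y \<mu> \<alpha> \<beta> \<longleftrightarrow>
     smooth_on M x \<and> smooth_on M y \<and> smooth_on M \<mu> \<and> smooth_on M \<alpha> \<and> smooth_on M \<beta> \<and>
     (\<forall>w\<in>M. x w \<noteq> y w \<and>
        cvec (du f w) = of_real (\<alpha> w) *s L (x w) \<and>
        cvec (dv f w) = of_real (\<beta> w) *s L (y w) \<and>
        of_real ((cmod (\<mu> w))\<^sup>2) * lor (W (x w) (y w)) (cnj_vec (W (x w) (y w))) = 2 \<and>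
        cvec (\<nu> w) = (1 / (2 * \<i>)) *s
          (\<mu> w *s W (x w) (y w) - cnj (\<mu> w) *s cnj_vec (W (x w) (y w))))"

end

theory Submission
  imports Defs
begin

text \<open>
  Write \<open>P = x' / (x - y)\<close> and \<open>Q = y' / (x - y)\<close>. The representation says that \<open>f\<close> is the real part
  of \<open>\<mu> W(x,y)\<close>. Differentiate it along \<open>u\<close> and \<open>v\<close> and require the results to be the null vectors
  \<open>\<alpha> L(x)\<close> and \<open>\<beta> L(y)\<close>. Since \<open>x\<close> and \<open>y\<close> are holomorphic, their derivatives along \<open>u\<close> and \<open>v\<close> differ
  only by the factor \<open>\<i>\<close>, and the equations become
  \<open>P = \<i> a e^{-\<i>\<theta>}\<close> and \<open>Q = b e^{\<i>\<theta>}\<close> with real functions \<open>a = \<beta> |x - y|\<close> and \<open>b = \<alpha> |x - y|\<close>,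
  which are positive because \<open>f_u\<close> and \<open>f_v\<close> are future directed. The derivative of the phase
  of \<open>\<mu>\<close> is the derivative of \<open>\<theta>\<close>, which yields \<open>P + Q = - 2 \<i> \<theta>_w\<close>
  (\<open>frame_quotients_on_surface\<close>).

  Let \<open>\<Phi>\<close> be the primitive of the holomorphic function \<open>P + Q\<close> with \<open>\<Phi>(w0) = - \<i> \<theta>(w0)\<close>. Its imaginary
  part is \<open>- \<theta>\<close>, so \<open>P e^{-\<Phi>}\<close> is imaginary and \<open>Q e^\<Phi>\<close> is real. Both are holomorphic, hence constant:
  \<open>P = C e^\<Phi>\<close> and \<open>Q = D e^{-\<Phi>}\<close>. Then \<open>P' = P (P + Q)\<close>, \<open>Q' = - Q (P + Q)\<close> and
  \<open>(x - y)' = (P - Q) (x - y)\<close>, so \<open>(P + Q) / (x - y)\<close> is constant too. With \<open>\<psi> = \<theta>(w0) + 2 (\<Phi> - \<Phi>(w0))\<close>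
  the quotient \<open>x' / y' = P / Q\<close> is \<open>k e^\<psi>\<close>, and the constant \<open>c = (P + Q) / (P Q (x - y))\<close> turns
  \<open>x' = P (x - y)\<close> into \<open>(1 + k e^\<psi>) / c\<close>, and likewise for \<open>y'\<close> (\<open>integrate_quotients\<close>). Here \<open>c\<close> is
  nonzero because otherwise \<open>\<theta>_w\<close> would vanish identically and \<open>\<theta>\<close> would be constant. The formulas
  for \<open>x\<close>, \<open>y\<close> and \<open>\<psi>\<close> follow by integration along paths, and \<open>\<psi>\<close> is harmonic because it is
  holomorphic.
\<close>

section \<open>Holomorphic functions are smooth and harmonic\<close>

lemma ck_on_cong_open:
  assumes "open S" "\<And>p. p \<in> S \<Longrightarrow> f p = g p"
  shows "ck_on n S f \<longleftrightarrow> ck_on n S g"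
  using assms(2)
proof (induction n arbitrary: f g)
  case 0
  then show ?case using continuous_on_cong by fastforce
next
  case (Suc n)
  have D: "(f has_derivative D) (at p) \<longleftrightarrow> (g has_derivative D) (at p)" if "p \<in> S" for p D
    using has_derivative_transform_within_open[OF _ \<open>open S\<close> that] Suc.prems by metis
  have "frechet_derivative f (at p) = frechet_derivative g (at p)" if "p \<in> S" for p
    unfolding frechet_derivative_def using D[OF that] by simp
  then have "ck_on n S (\<lambda>p. frechet_derivative f (at p) d) \<longleftrightarrow>
      ck_on n S (\<lambda>p. frechet_derivative g (at p) d)" for d
    by (intro Suc.IH) simp
  then show ?case using D by (auto simp: differentiable_def)
qed

lemma has_derivative_Re_cmult:
  assumes "(g has_field_derivative g') (at p)"
  shows "((\<lambda>w. Re (c * g w)) has_derivative (\<lambda>d. Re (c * d * g'))) (at p)"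
  using assms unfolding has_field_derivative_def
  by (auto intro!: derivative_eq_intros simp: algebra_simps)

text \<open>
  The factor \<open>c\<close> makes the induction work, because the derivative of \<open>Re (c g)\<close> in direction \<open>d\<close> is
  \<open>Re (c d g')\<close>, again of this form. It also covers the imaginary part, with \<open>c = - \<i>\<close>.
\<close>

lemma ck_on_Re_holomorphic:
  assumes "open S" "g holomorphic_on S"
  shows "ck_on n S (\<lambda>w. Re (c * g w))"
  using assms(2)
proof (induction n arbitrary: g c)
  case 0
  then show ?case
    by (auto intro!: continuous_intros holomorphic_on_imp_continuous_on)
next
  case (Suc n)
  have D: "((\<lambda>w. Re (c * g w)) has_derivative (\<lambda>d. Re (c * d * deriv g p))) (at p)" if "p \<in> S" for p
    by (rule has_derivative_Re_cmult) (use Suc.prems \<open>open S\<close> that holomorphic_derivI in blast)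
  have "ck_on n S (\<lambda>p. frechet_derivative (\<lambda>w. Re (c * g w)) (at p) d)" for d
  proof -
    have "ck_on n S (\<lambda>p. Re ((c * d) * deriv g p))"
      by (rule Suc.IH) (use Suc.prems \<open>open S\<close> holomorphic_deriv in blast)
    moreover have "frechet_derivative (\<lambda>w. Re (c * g w)) (at p) d = Re ((c * d) * deriv g p)"
      if "p \<in> S" for p
      using frechet_derivative_at[OF D[OF that]] by metis
    ultimately show ?thesis
      using ck_on_cong_open[OF \<open>open S\<close>] by (metis (no_types, lifting))
  qed
  then show ?case using D by (auto simp: differentiable_def)
qed

text \<open>
  The second derivative in direction \<open>d\<close> is \<open>Re (c d\<^sup>2 g'')\<close>, and \<open>1\<^sup>2 + \<i>\<^sup>2 = 0\<close>.
\<close>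

lemma harmonic_on_Re_holomorphic:
  assumes "open S" "g holomorphic_on S"
  shows "harmonic_on S (\<lambda>w. Re (c * g w))"
proof -
  define F where "F c g d p = frechet_derivative (\<lambda>w. Re (c * g w)) (at p) d" for c and g :: "complex \<Rightarrow> complex" and d p
  have F: "F c g d p = Re (c * d * deriv g p)" if "g holomorphic_on S" "p \<in> S" for c g d p
  proof -
    have "((\<lambda>w. Re (c * g w)) has_derivative (\<lambda>d. Re (c * d * deriv g p))) (at p)"
      by (rule has_derivative_Re_cmult) (use \<open>open S\<close> that holomorphic_derivI in blast)
    then show ?thesis unfolding F_def using frechet_derivative_at by metis
  qed
  have FF: "frechet_derivative (F c g d) (at p) d = Re (c * d * d * deriv (deriv g) p)" if "p \<in> S" for p d
  proof -
    have "((\<lambda>w. Re (c * d * deriv g w)) has_derivative (\<lambda>e. Re (c * d * e * deriv (deriv g) p))) (at p)"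
      by (rule has_derivative_Re_cmult)
         (use assms that holomorphic_derivI holomorphic_deriv in blast)
    then have "(F c g d has_derivative (\<lambda>e. Re (c * d * e * deriv (deriv g) p))) (at p)"
      by (rule has_derivative_transform_within_open[OF _ \<open>open S\<close> \<open>p \<in> S\<close>]) (simp add: F assms)
    then show ?thesis using frechet_derivative_at by metis
  qed
  have "du (du (\<lambda>w. Re (c * g w))) p + dv (dv (\<lambda>w. Re (c * g w))) p = 0" if "p \<in> S" for p
  proof -
    have "du (\<lambda>w. Re (c * g w)) = F c g 1" "dv (\<lambda>w. Re (c * g w)) = F c g \<i>"
      by (auto simp: F_def du_def dv_def)
    then show ?thesis using FF[OF that, of 1] FF[OF that, of \<i>] by (simp add: du_def dv_def algebra_simps)
  qed
  then show ?thesis unfolding harmonic_on_def using ck_on_Re_holomorphic[OF assms] by blast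
qed

lemma complex_harmonic_on_holomorphic:
  assumes "open S" "g holomorphic_on S"
  shows "complex_harmonic_on S g"
  unfolding complex_harmonic_on_def
  using harmonic_on_Re_holomorphic[OF assms, of 1] harmonic_on_Re_holomorphic[OF assms, of "- \<i>"]
  by simp

section \<open>Derivatives and primitives of functions of a complex variable\<close>

lemma zero_derivative_constant:
  fixes f :: "complex \<Rightarrow> 'b::banach"
  assumes "open S" "connected S" "\<And>z. z \<in> S \<Longrightarrow> (f has_derivative (\<lambda>h. 0)) (at z)" "a \<in> S" "b \<in> S"
  shows "f a = f b"
proof -
  have "continuous_on S f"
    using assms(3) has_derivative_continuous continuous_at_imp_continuous_on by blast
  then have "f constant_on S"
    using has_derivative_zero_connected_constant_on[of S "{}" f] assms has_derivative_at_withinI by blast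
  then show ?thesis using assms(4,5) by (auto simp: constant_on_def)
qed

lemma holomorphic_real_valued_constant:
  assumes "open S" "connected S" "g holomorphic_on S" "\<And>z. z \<in> S \<Longrightarrow> Im (g z) = 0" "a \<in> S" "b \<in> S"
  shows "g a = g b"
proof (rule zero_derivative_constant[OF assms(1,2) _ assms(5,6)])
  fix z assume z: "z \<in> S"
  have D: "(g has_derivative (\<lambda>d. deriv g z * d)) (at z)"
    using holomorphic_derivI[OF assms(3,1) z] by (simp add: has_field_derivative_def)
  have "((\<lambda>w. Im (g w)) has_derivative (\<lambda>d. Im (deriv g z * d))) (at z)"
    using D by (auto intro!: derivative_eq_intros)
  moreover have "((\<lambda>w. Im (g w)) has_derivative (\<lambda>d. 0)) (at z)"
    by (rule has_derivative_transform_within_open[of "\<lambda>_. 0", OF _ \<open>open S\<close> z]) (use assms(4) in auto)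
  ultimately have "(\<lambda>d. Im (deriv g z * d)) = (\<lambda>d. 0)"
    by (rule has_derivative_unique)
  from fun_cong[OF this, of 1] fun_cong[OF this, of \<i>] have "deriv g z = 0"
    by (simp add: complex_eq_iff)
  then show "(g has_derivative (\<lambda>h. 0)) (at z)" using D by simp
qed

lemma contour_integral_primitive_eq:
  assumes "\<And>z. z \<in> M \<Longrightarrow> (F has_field_derivative g z) (at z)" "\<gamma> \<in> paths_in M a b"
  shows "g contour_integrable_on \<gamma>" "contour_integral \<gamma> g = F b - F a"
proof -
  have "(g has_contour_integral (F (pathfinish \<gamma>) - F (pathstart \<gamma>))) \<gamma>"
    by (rule contour_integral_primitive[of M])
       (use assms in \<open>auto simp: paths_in_def intro: has_field_derivative_at_within\<close>)
  then have "(g has_contour_integral (F b - F a)) \<gamma>"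
    using assms(2) by (simp add: paths_in_def)
  then show "g contour_integrable_on \<gamma>" "contour_integral \<gamma> g = F b - F a"
    using has_contour_integral_integrable contour_integral_unique by blast+
qed

lemma has_derivative_du_dv:
  fixes \<theta> :: "complex \<Rightarrow> real"
  assumes "\<theta> differentiable (at z)"
  shows "(\<theta> has_derivative (\<lambda>d. Re d * du \<theta> z + Im d * dv \<theta> z)) (at z)"
proof -
  have D: "(\<theta> has_derivative frechet_derivative \<theta> (at z)) (at z)"
    using assms frechet_derivative_works by blast
  then interpret bounded_linear "frechet_derivative \<theta> (at z)" by (rule has_derivative_bounded_linear)
  have "frechet_derivative \<theta> (at z) d = Re d * du \<theta> z + Im d * dv \<theta> z" for d
  proof -
    have "d = Re d *\<^sub>R 1 + Im d *\<^sub>R \<i>" by (simp add: complex_eq_iff)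
    then have "frechet_derivative \<theta> (at z) d = frechet_derivative \<theta> (at z) (Re d *\<^sub>R 1 + Im d *\<^sub>R \<i>)" by simp
    then show ?thesis by (simp add: add scaleR du_def dv_def)
  qed
  then show ?thesis using D by (metis (no_types, lifting) ext)
qed

lemma smooth_on_differentiable:
  assumes "smooth_on S f" "p \<in> S"
  shows "f differentiable (at p)"
proof -
  have "ck_on (Suc 0) S f" using assms(1) unfolding smooth_on_def by blast
  then show ?thesis using assms(2) by simp
qed

section \<open>The derivatives of the surface\<close>

lemma vector_4:
  fixes a b c d :: "'a::zero"
  shows "(vector [a, b, c, d] :: 'a ^ 4) $ 1 = a" "(vector [a, b, c, d] :: 'a ^ 4) $ 2 = b"
    "(vector [a, b, c, d] :: 'a ^ 4) $ 3 = c" "(vector [a, b, c, d] :: 'a ^ 4) $ 4 = d"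
  unfolding vector_def by simp_all

text \<open>
  Up to common factors, the components of \<open>W(x,y)\<close> and \<open>L(p)\<close> are sums and differences of the entries
  of the matrices \<open>(x,1) (cnj y, 1)^T\<close> and \<open>(p,1) (cnj p, 1)^T\<close>. The three equations are the entries of
  the derivative of \<open>f\<close> in these matrix coordinates: lower right, upper right and upper left.
\<close>

lemma surface_derivative:
  assumes "open M" "z \<in> M" and f: "(f has_derivative f') (at z)"
    and x: "(x has_derivative X) (at z)" and y: "(y has_derivative Y) (at z)"
    and \<mu>: "(\<mu> has_derivative m) (at z)"
    and rep: "\<forall>w\<in>M. cvec (f w) =
           (1/2) *s (\<mu> w *s W (x w) (y w) + cnj (\<mu> w) *s cnj_vec (W (x w) (y w)))"
    and tangent: "cvec (f' d) = of_real \<alpha> *s L p"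
  shows "m d + cnj (m d) = 2 * of_real \<alpha>"
    and "m d * x z + \<mu> z * X d + cnj (m d) * y z + cnj (\<mu> z) * Y d = 2 * of_real \<alpha> * p"
    and "(m d * x z * cnj (y z) + \<mu> z * X d * cnj (y z) + \<mu> z * x z * cnj (Y d))
       + cnj (m d * x z * cnj (y z) + \<mu> z * X d * cnj (y z) + \<mu> z * x z * cnj (Y d))
       = 2 * of_real \<alpha> * (p * cnj p)"
proof -
  have comp: "f w $ i = Re (\<mu> w * W (x w) (y w) $ i)" if "w \<in> M" for w i
  proof -
    have "cvec (f w) $ i = ((1/2) *s (\<mu> w *s W (x w) (y w) + cnj (\<mu> w) *s cnj_vec (W (x w) (y w)))) $ i"
      using rep that by simp
    from arg_cong[OF this, of Re] show ?thesis by (simp add: cvec_def cnj_vec_def)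
  qed
  have eq: "f' d $ i = D d"
    if "((\<lambda>w. Re (\<mu> w * W (x w) (y w) $ i)) has_derivative D) (at z)" for i D
  proof -
    have "((\<lambda>w. f w $ i) has_derivative (\<lambda>d. f' d $ i)) (at z)"
      by (rule bounded_linear.has_derivative[OF bounded_linear_vec_nth f])
    moreover have "((\<lambda>w. f w $ i) has_derivative D) (at z)"
      by (rule has_derivative_transform_within_open[OF that \<open>open M\<close> \<open>z \<in> M\<close>]) (simp add: comp)
    ultimately have "(\<lambda>d. f' d $ i) = D" by (rule has_derivative_unique)
    then show ?thesis by metis
  qed
  have t: "f' d $ i = Re (of_real \<alpha> * L p $ i)" for i
    using arg_cong[OF tangent, of "\<lambda>v. Re (v $ i)"] by (simp add: cvec_def)
  note [derivative_intros] = x y \<mu>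
  have "f' d $ 1 = Re (m d * (1 + x z * cnj (y z)) + \<mu> z * (X d * cnj (y z) + x z * cnj (Y d)))"
    by (rule eq) (auto simp: W_def vector_4 intro!: derivative_eq_intros simp: algebra_simps)
  moreover have "f' d $ 2 = Re (m d * (x z + cnj (y z)) + \<mu> z * (X d + cnj (Y d)))"
    by (rule eq) (auto simp: W_def vector_4 intro!: derivative_eq_intros simp: algebra_simps)
  moreover have "f' d $ 3 = Re (- \<i> * (m d * (x z - cnj (y z)) + \<mu> z * (X d - cnj (Y d))))"
    by (rule eq) (auto simp: W_def vector_4 intro!: derivative_eq_intros simp: algebra_simps)
  moreover have "f' d $ 4 = Re (m d * (- 1 + x z * cnj (y z)) + \<mu> z * (X d * cnj (y z) + x z * cnj (Y d)))"
    by (rule eq) (auto simp: W_def vector_4 intro!: derivative_eq_intros simp: algebra_simps)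
  ultimately show "m d + cnj (m d) = 2 * of_real \<alpha>"
    and "m d * x z + \<mu> z * X d + cnj (m d) * y z + cnj (\<mu> z) * Y d = 2 * of_real \<alpha> * p"
    and "(m d * x z * cnj (y z) + \<mu> z * X d * cnj (y z) + \<mu> z * x z * cnj (Y d))
       + cnj (m d * x z * cnj (y z) + \<mu> z * X d * cnj (y z) + \<mu> z * x z * cnj (Y d))
       = 2 * of_real \<alpha> * (p * cnj p)"
    using t[of 1] t[of 2] t[of 3] t[of 4]
    unfolding L_def vector_4 complex_eq_iff by (simp_all add: algebra_simps)
qed

text \<open>
  Eliminating \<open>m\<close> from the equations of \<open>surface_derivative\<close> with \<open>p = x\<close>. They are invariant under
  exchanging \<open>(x, X, \<mu>, m)\<close> with \<open>(y, Y, cnj \<mu>, cnj m)\<close>, because \<open>W(y,x)\<close> is the conjugate of \<open>W(x,y)\<close>,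
  so the result also serves the direction in which \<open>p = y\<close>.
\<close>

lemma null_direction_equations:
  fixes x y \<mu> m X Y a :: complex
  assumes "m + cnj m = 2 * a"
    and "m * x + \<mu> * X + cnj m * y + cnj \<mu> * Y = 2 * a * x"
    and "(m * x * cnj y + \<mu> * X * cnj y + \<mu> * x * cnj Y)
       + cnj (m * x * cnj y + \<mu> * X * cnj y + \<mu> * x * cnj Y) = 2 * a * (x * cnj x)"
  shows "cnj m * (x - y) = \<mu> * X + cnj \<mu> * Y"
    and "Re (\<mu> * X * cnj (x - y)) = 0"
proof -
  show *: "cnj m * (x - y) = \<mu> * X + cnj \<mu> * Y"
    using assms(1,2) by algebra
  have "m * (cnj x - cnj y) = cnj \<mu> * cnj X + \<mu> * cnj Y"
    using arg_cong[OF *, of cnj] by simp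
  then have "\<mu> * X * cnj (x - y) + cnj (\<mu> * X * cnj (x - y)) = 0"
    using * assms(1,3) unfolding complex_cnj_mult complex_cnj_add complex_cnj_diff complex_cnj_cnj by algebra
  moreover have "Re c = 0" if "c + cnj c = 0" for c
    using that by (simp add: complex_eq_iff)
  ultimately show "Re (\<mu> * X * cnj (x - y)) = 0" by blast
qed

text \<open>
  The function \<open>e^{-\<i>\<theta>} \<mu> = 1 / R\<close> is real, so the imaginary part of its derivative vanishes. This
  gives the derivative of \<open>\<theta>\<close> without differentiating the modulus \<open>R\<close>.
\<close>

lemma phase_derivative:
  assumes "open M" "z \<in> M" "\<forall>w\<in>M. \<mu> w = exp (\<i> * of_real (\<theta> w)) / of_real (R w)"
    and \<mu>: "(\<mu> has_derivative m) (at z)" and \<theta>: "(\<theta> has_derivative t) (at z)"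
  shows "Im (exp (- \<i> * of_real (\<theta> z)) * m d) = t d / R z"
proof -
  have real: "Im (exp (- \<i> * of_real (\<theta> w)) * \<mu> w) = 0" if "w \<in> M" for w
  proof -
    have "exp (- \<i> * of_real (\<theta> w)) * \<mu> w = of_real (1 / R w)"
      using assms(3) that by (simp add: exp_minus field_simps)
    then show ?thesis by simp
  qed
  define D where "D d = Im (exp (- \<i> * of_real (\<theta> z)) * (m d - \<i> * of_real (t d) * \<mu> z))" for d
  have "((\<lambda>w. - \<i> * complex_of_real (\<theta> w)) has_derivative (\<lambda>d. - \<i> * of_real (t d))) (at z)"
    by (intro derivative_intros \<theta>)
  from has_derivative_compose[OF this DERIV_exp[unfolded has_field_derivative_def]]
  have e: "((\<lambda>w. exp (- \<i> * complex_of_real (\<theta> w))) has_derivative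
      (\<lambda>d. exp (- \<i> * of_real (\<theta> z)) * (- \<i> * of_real (t d)))) (at z)" .
  have "((\<lambda>w. Im (exp (- \<i> * of_real (\<theta> w)) * \<mu> w)) has_derivative D) (at z)"
    unfolding D_def
    by (rule has_derivative_eq_rhs[OF has_derivative_Im[OF has_derivative_mult[OF e \<mu>]]])
       (simp add: algebra_simps fun_eq_iff)
  moreover have "((\<lambda>w. Im (exp (- \<i> * of_real (\<theta> w)) * \<mu> w)) has_derivative (\<lambda>d. 0)) (at z)"
    by (rule has_derivative_transform_within_open[of "\<lambda>_. 0", OF _ \<open>open M\<close> \<open>z \<in> M\<close>])
       (use real in auto)
  ultimately have "D = (\<lambda>d. 0)" by (rule has_derivative_unique)
  then have "D d = 0" by simp
  have R: "exp (- \<i> * of_real (\<theta> z)) * \<mu> z = of_real (1 / R z)"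
    using assms(2,3) by (simp add: exp_minus field_simps)
  have "exp (- \<i> * of_real (\<theta> z)) * (m d - \<i> * of_real (t d) * \<mu> z)
      = exp (- \<i> * of_real (\<theta> z)) * m d - \<i> * of_real (t d) * of_real (1 / R z)"
    unfolding R[symmetric] by (simp add: algebra_simps)
  then have "D d = Im (exp (- \<i> * of_real (\<theta> z)) * m d) - t d / R z"
    unfolding D_def by (simp only:) simp
  with \<open>D d = 0\<close> show ?thesis by linarith
qed

text \<open>
  Pointwise algebra: \<open>m\<close> and \<open>n\<close> are the derivatives of \<open>\<mu>\<close> along \<open>u\<close> and \<open>v\<close>, and \<open>s\<close>, \<open>t\<close> those of the
  phase \<open>\<theta>\<close>. The third equations for \<open>m\<close> and \<open>n\<close> fix the phases of the quotients, the second ones then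
  give \<open>m = r (b - \<i> a)\<close> and \<open>n = r (a - \<i> b)\<close>. The real parts are \<open>\<alpha> = r b\<close> and \<open>\<beta> = r a\<close>, whence the
  signs, and the imaginary parts of \<open>e^{-\<i>\<theta>} m\<close> and \<open>e^{-\<i>\<theta>} n\<close> yield the sum of the quotients.
\<close>

lemma frame_quotients:
  fixes x y \<mu> m n X Y :: complex and \<alpha> \<beta> \<theta> r s t :: real
  assumes "x \<noteq> y" "r > 0" "\<alpha> > 0" "\<beta> > 0" and \<mu>: "\<mu> = exp (\<i> * of_real \<theta>) * of_real r"
    and m: "m + cnj m = 2 * of_real \<alpha>" "cnj m * (x - y) = \<mu> * X + cnj \<mu> * Y"
      "Re (\<mu> * X * cnj (x - y)) = 0"
    and n: "n + cnj n = 2 * of_real \<beta>" "n * (y - x) = cnj \<mu> * (\<i> * Y) + \<mu> * (\<i> * X)"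
      "Re (cnj \<mu> * (\<i> * Y) * cnj (y - x)) = 0"
    and s: "Im (exp (- \<i> * of_real \<theta>) * m) = s * r"
    and t: "Im (exp (- \<i> * of_real \<theta>) * n) = t * r"
  shows "\<exists>a b. a > 0 \<and> b > 0 \<and> X / (x - y) = \<i> * of_real a * exp (- \<i> * of_real \<theta>)
    \<and> Y / (x - y) = of_real b * exp (\<i> * of_real \<theta>)"
    and "X / (x - y) + Y / (x - y) = - \<i> * (of_real s - \<i> * of_real t)"
proof -
  define h P Q where "h = x - y" and "P = X / h" and "Q = Y / h"
  define E e where "E = exp (\<i> * of_real \<theta>)" and "e = exp (- \<i> * of_real \<theta>)"
  have h: "h \<noteq> 0" using assms(1) by (simp add: h_def)
  have X: "X = P * h" and Y: "Y = Q * h" using h by (auto simp: P_def Q_def)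
  have Ee: "E * e = 1" "cnj E = e" "cnj e = E"
    by (simp_all add: E_def e_def exp_minus exp_cnj)
  have \<mu>': "\<mu> = E * of_real r" "cnj \<mu> = e * of_real r"
    using \<mu> Ee by (simp_all add: E_def[symmetric])
  have Re_of_real_mult: "Re (of_real u * c) = u * Re c" for u c by simp
  define a b where "a = Im (E * P)" and "b = Re (e * Q)"
  have hh: "h * cnj h = of_real ((cmod h)\<^sup>2)" by (rule complex_norm_square[symmetric])
  have "\<mu> * X * cnj (x - y) = of_real (r * (cmod h)\<^sup>2) * (E * P)"
    unfolding X \<mu>' h_def[symmetric] of_real_mult hh[symmetric] by (simp add: algebra_simps)
  with m(3) have "r * (cmod h)\<^sup>2 * Re (E * P) = 0" by (simp only: Re_of_real_mult)
  then have "Re (E * P) = 0" using h \<open>r > 0\<close> by simp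
  then have EP: "E * P = \<i> * of_real a" by (simp add: a_def complex_eq_iff)
  have "cnj \<mu> * (\<i> * Y) * cnj (y - x) = of_real (r * (cmod h)\<^sup>2) * (- \<i> * (e * Q))"
    unfolding Y \<mu>' h_def[symmetric] of_real_mult hh[symmetric] by (simp add: h_def Ee(2) algebra_simps)
  with n(3) have "r * (cmod h)\<^sup>2 * Re (- \<i> * (e * Q)) = 0" by (simp only: Re_of_real_mult)
  then have "Im (e * Q) = 0" using h \<open>r > 0\<close> by simp
  then have eQ: "e * Q = of_real b" by (simp add: b_def complex_eq_iff)
  have "cnj m * h = of_real r * (E * P + e * Q) * h"
    using m(2) unfolding X Y \<mu>' h_def[symmetric] by (simp add: Ee(2) algebra_simps)
  then have "cnj m = of_real r * (\<i> * of_real a + of_real b)" using h EP eQ by simp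
  from arg_cong[OF this, of cnj] have m': "m = of_real r * (of_real b - \<i> * of_real a)"
    by (simp add: algebra_simps)
  have "n * h = - \<i> * of_real r * (E * P + e * Q) * h"
    using n(2) unfolding X Y \<mu>' by (simp add: h_def Ee(2) algebra_simps)
  then have "n = - \<i> * of_real r * (E * P + e * Q)" using mult_right_cancel[OF h] by blast
  then have n': "n = of_real r * (of_real a - \<i> * of_real b)"
    unfolding EP eQ by (simp add: algebra_simps)
  have "\<alpha> = r * b" using arg_cong[OF m(1), of Re] m' by (simp add: mult.commute)
  then have "b > 0" using \<open>\<alpha> > 0\<close> \<open>r > 0\<close> by (simp add: zero_less_mult_iff)
  have "\<beta> = r * a" using arg_cong[OF n(1), of Re] n' by (simp add: mult.commute)
  then have "a > 0" using \<open>\<beta> > 0\<close> \<open>r > 0\<close> by (simp add: zero_less_mult_iff)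
  have P: "P = \<i> * of_real a * e" and Q: "Q = of_real b * E"
    using EP eQ Ee(1) by algebra+
  then show "\<exists>a b. a > 0 \<and> b > 0 \<and> X / (x - y) = \<i> * of_real a * exp (- \<i> * of_real \<theta>)
    \<and> Y / (x - y) = of_real b * exp (\<i> * of_real \<theta>)"
    using \<open>a > 0\<close> \<open>b > 0\<close> unfolding P_def Q_def h_def E_def e_def by blast
  have "r * Im (e * (of_real b - \<i> * of_real a)) = r * s"
    using s unfolding m' e_def[symmetric] by (simp add: algebra_simps)
  then have s': "s = Im (e * (of_real b - \<i> * of_real a))" using \<open>r > 0\<close> by simp
  have "r * Im (e * (of_real a - \<i> * of_real b)) = r * t"
    using t unfolding n' e_def[symmetric] by (simp add: algebra_simps)
  then have t': "t = Im (e * (of_real a - \<i> * of_real b))" using \<open>r > 0\<close> by simp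
  have E_parts: "Re E = Re e" "Im E = - Im e" using Ee(2) by (auto simp: complex_eq_iff)
  have "P + Q = - \<i> * (of_real s - \<i> * of_real t)"
    unfolding P Q s' t' by (simp add: complex_eq_iff E_parts algebra_simps)
  then show "X / (x - y) + Y / (x - y) = - \<i> * (of_real s - \<i> * of_real t)"
    by (simp add: P_def Q_def h_def)
qed

lemma frame_quotients_on_surface:
  assumes surf: "isotropic_surface M f"
    and std: "standing_representation M f \<nu> x y \<mu> \<alpha> \<beta>"
    and rep: "\<forall>w\<in>M. cvec (f w) =
           (1/2) *s (\<mu> w *s W (x w) (y w) + cnj (\<mu> w) *s cnj_vec (W (x w) (y w)))"
    and \<mu>: "\<forall>w\<in>M. \<mu> w = exp (\<i> * of_real (\<theta> w)) / of_real (cmod (x w - y w))"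
    and \<theta>: "\<theta> differentiable (at z)"
    and x: "x holomorphic_on M" and y: "y holomorphic_on M" and z: "z \<in> M"
  shows "\<exists>a b. a > 0 \<and> b > 0
       \<and> deriv x z / (x z - y z) = \<i> * of_real a * exp (- \<i> * of_real (\<theta> z))
       \<and> deriv y z / (x z - y z) = of_real b * exp (\<i> * of_real (\<theta> z))"
    and "deriv x z / (x z - y z) + deriv y z / (x z - y z) = - 2 * \<i> * dw \<theta> z"
proof -
  have M: "open M" and light: "future_lightlike (du f z)" "future_lightlike (dv f z)"
    and smf: "smooth_on M f"
    using surf z by (auto simp: isotropic_surface_def)
  have xy: "x z \<noteq> y z" and fu: "cvec (du f z) = of_real (\<alpha> z) *s L (x z)"
    and fv: "cvec (dv f z) = of_real (\<beta> z) *s L (y z)" and sm\<mu>: "smooth_on M \<mu>"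
    using std z by (auto simp: standing_representation_def)
  \<comment> \<open>The first component of \<open>L(c)\<close> is positive.\<close>
  have pos: "r > 0" if "future_lightlike p" "cvec p = of_real r *s L c" for r p c
  proof -
    have "p $ 1 = r * (1 + (cmod c)\<^sup>2)"
      using arg_cong[OF that(2), of "\<lambda>v::complex ^ 4. Re (v $ 1)"]
      unfolding cmod_power2 by (simp add: cvec_def L_def vector_4 power2_eq_square)
    moreover have "1 + (cmod c)\<^sup>2 > 0" by (simp add: add_pos_nonneg)
    ultimately show ?thesis using that(1)
      by (simp add: future_lightlike_def zero_less_mult_iff)
  qed
  define m where "m = frechet_derivative \<mu> (at z)"
  have D: "(f has_derivative frechet_derivative f (at z)) (at z)" "(\<mu> has_derivative m) (at z)"
    unfolding m_def using smooth_on_differentiable smf sm\<mu> z frechet_derivative_works by blast+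
  have Dxy: "(x has_derivative (\<lambda>d. deriv x z * d)) (at z)" "(y has_derivative (\<lambda>d. deriv y z * d)) (at z)"
    using holomorphic_derivI[OF x M z] holomorphic_derivI[OF y M z] by (simp_all add: has_field_derivative_def)
  note eq_u = surface_derivative[OF M z D(1) Dxy D(2) rep fu[unfolded du_def]]
  note eq_v = surface_derivative[OF M z D(1) Dxy D(2) rep fv[unfolded dv_def]]
  note u = null_direction_equations[OF eq_u]
  \<comment> \<open>Along \<open>v\<close> the tangent is a multiple of \<open>L(y)\<close>: the same equations with \<open>x\<close> and \<open>y\<close> exchanged.\<close>
  have "cnj (m \<i>) + cnj (cnj (m \<i>)) = 2 * of_real (\<beta> z)"
    using eq_v(1) by (simp only: complex_cnj_cnj ac_simps)
  moreover have "cnj (m \<i>) * y z + cnj (\<mu> z) * (deriv y z * \<i>) + cnj (cnj (m \<i>)) * x z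
      + cnj (cnj (\<mu> z)) * (deriv x z * \<i>) = 2 * of_real (\<beta> z) * y z"
    using eq_v(2) by (simp only: complex_cnj_cnj ac_simps)
  moreover have "(cnj (m \<i>) * y z * cnj (x z) + cnj (\<mu> z) * (deriv y z * \<i>) * cnj (x z)
        + cnj (\<mu> z) * y z * cnj (deriv x z * \<i>))
      + cnj (cnj (m \<i>) * y z * cnj (x z) + cnj (\<mu> z) * (deriv y z * \<i>) * cnj (x z)
        + cnj (\<mu> z) * y z * cnj (deriv x z * \<i>)) = 2 * of_real (\<beta> z) * (y z * cnj (y z))"
    using eq_v(3) by (simp only: complex_cnj_add complex_cnj_mult complex_cnj_cnj ac_simps)
  ultimately have "cnj (cnj (m \<i>)) * (y z - x z)
      = cnj (\<mu> z) * (deriv y z * \<i>) + cnj (cnj (\<mu> z)) * (deriv x z * \<i>)"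
    and "Re (cnj (\<mu> z) * (deriv y z * \<i>) * cnj (y z - x z)) = 0"
    by (rule null_direction_equations)+
  then have v: "m \<i> * (y z - x z) = cnj (\<mu> z) * (\<i> * deriv y z) + \<mu> z * (\<i> * deriv x z)"
      "Re (cnj (\<mu> z) * (\<i> * deriv y z) * cnj (y z - x z)) = 0"
    by (simp_all only: complex_cnj_cnj mult.commute[of \<i>])
  note phase = phase_derivative[OF M z \<mu> D(2) has_derivative_du_dv[OF \<theta>]]
  define r where "r = 1 / cmod (x z - y z)"
  have r: "r > 0" using xy by (simp add: r_def)
  have \<mu>r: "\<mu> z = exp (\<i> * of_real (\<theta> z)) * of_real r" using \<mu> z by (simp add: r_def)
  have s: "Im (exp (- \<i> * of_real (\<theta> z)) * m 1) = du \<theta> z * r"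
    and t: "Im (exp (- \<i> * of_real (\<theta> z)) * m \<i>) = dv \<theta> z * r"
    using phase[of 1] phase[of \<i>] by (simp_all add: r_def)
  note fq = xy r pos[OF light(1) fu] pos[OF light(2) fv] \<mu>r
    eq_u(1) u[unfolded mult_1_right] eq_v(1) v s t
  show "\<exists>a b. a > 0 \<and> b > 0
       \<and> deriv x z / (x z - y z) = \<i> * of_real a * exp (- \<i> * of_real (\<theta> z))
       \<and> deriv y z / (x z - y z) = of_real b * exp (\<i> * of_real (\<theta> z))"
    by (rule frame_quotients(1)[OF fq])
  show "deriv x z / (x z - y z) + deriv y z / (x z - y z) = - 2 * \<i> * dw \<theta> z"
    unfolding frame_quotients(2)[OF fq] dw_def by simp
qed

section \<open>Integration of the equations for the quotients\<close>

text \<open>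
  The phase conditions and the equation for the sum determine the quotients up to constants: they are
  multiples of \<open>e^\<Phi>\<close> and \<open>e^{-\<Phi>}\<close> for a primitive \<open>\<Phi>\<close> of their sum.
\<close>

lemma integrate_quotients:
  fixes x y :: "complex \<Rightarrow> complex" and \<theta> :: "complex \<Rightarrow> real"
  assumes M: "open M" "connected M" "simply_connected M" and w0: "w0 \<in> M"
    and x: "x holomorphic_on M" and y: "y holomorphic_on M"
    and xy: "\<And>w. w \<in> M \<Longrightarrow> x w \<noteq> y w"
    and \<theta>: "\<And>w. w \<in> M \<Longrightarrow> \<theta> differentiable (at w)" "\<not> \<theta> constant_on M"
    and phase: "\<And>w. w \<in> M \<Longrightarrow> \<exists>a b. a > 0 \<and> b > 0
       \<and> deriv x w / (x w - y w) = \<i> * of_real a * exp (- \<i> * of_real (\<theta> w))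
       \<and> deriv y w / (x w - y w) = of_real b * exp (\<i> * of_real (\<theta> w))"
    and sum: "\<And>w. w \<in> M \<Longrightarrow> deriv x w / (x w - y w) + deriv y w / (x w - y w) = - 2 * \<i> * dw \<theta> w"
  shows "\<exists>k c \<Psi>. k \<noteq> 0 \<and> c \<noteq> 0 \<and> \<Psi> w0 = of_real (\<theta> w0) \<and>
    (\<forall>w\<in>M. (\<Psi> has_field_derivative - 4 * \<i> * dw \<theta> w) (at w) \<and>
       deriv x w = 1 / c * (1 + k * exp (\<Psi> w)) \<and>
       deriv y w = 1 / (c * k) * (k + exp (- \<Psi> w)))"
proof -
  define h P Q where "h w = x w - y w" and "P w = deriv x w / h w" and "Q w = deriv y w / h w" for w
  have h: "h w \<noteq> 0" if "w \<in> M" for w using xy that by (simp add: h_def)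
  have hol: "h holomorphic_on M" "P holomorphic_on M" "Q holomorphic_on M"
    unfolding P_def Q_def h_def
    using x y xy M(1) by (auto intro!: holomorphic_intros holomorphic_deriv)
  have PQ: "P w + Q w = - 2 * \<i> * dw \<theta> w" if "w \<in> M" for w
    using sum[OF that] by (simp add: P_def Q_def h_def)
  have "(\<lambda>w. P w + Q w) holomorphic_on M" using hol by (intro holomorphic_intros)
  then obtain \<Phi>0 where \<Phi>0: "\<And>w. w \<in> M \<Longrightarrow> (\<Phi>0 has_field_derivative (P w + Q w)) (at w)"
    using simply_connected_eq_global_primitive[OF M(1)] M(3) by metis
  \<comment> \<open>The constant makes \<open>Im \<Phi>\<close> equal to \<open>- \<theta>\<close>, and not merely up to a constant.\<close>
  define \<Phi> where "\<Phi> w = \<Phi>0 w - \<Phi>0 w0 - \<i> * of_real (\<theta> w0)" for w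
  have \<Phi>: "(\<Phi> has_field_derivative (P w + Q w)) (at w)" if "w \<in> M" for w
    unfolding \<Phi>_def by (auto intro!: derivative_eq_intros \<Phi>0 that)
  have hol\<Phi>: "\<Phi> holomorphic_on M"
    using \<Phi> M(1) holomorphic_on_open by blast
  have Im\<Phi>: "Im (\<Phi> w) = - \<theta> w" if "w \<in> M" for w
  proof -
    have "Im (\<Phi> w) + \<theta> w = Im (\<Phi> w0) + \<theta> w0"
    proof (rule zero_derivative_constant[OF M(1,2) _ that w0])
      fix z assume z: "z \<in> M"
      have D: "(\<Phi> has_derivative (\<lambda>d. (P z + Q z) * d)) (at z)"
        using \<Phi>[OF z] by (simp add: has_field_derivative_def)
      note [derivative_intros] = D has_derivative_du_dv[OF \<theta>(1)[OF z]]
      show "((\<lambda>w. Im (\<Phi> w) + \<theta> w) has_derivative (\<lambda>h. 0)) (at z)"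
        by (rule derivative_eq_intros refl)+ (auto simp: PQ[OF z] dw_def fun_eq_iff algebra_simps)
    qed
    then show ?thesis by (simp add: \<Phi>_def)
  qed
  have exp\<Phi>: "exp (\<Phi> w) = of_real (exp (Re (\<Phi> w))) * exp (- \<i> * of_real (\<theta> w))" if "w \<in> M" for w
  proof -
    have "\<Phi> w = of_real (Re (\<Phi> w)) + - \<i> * of_real (\<theta> w)"
      using Im\<Phi>[OF that] by (simp add: complex_eq_iff)
    then show ?thesis by (metis exp_add exp_of_real)
  qed
  \<comment> \<open>Now \<open>e^\<Phi>\<close> has the phase of \<open>- \<i> P\<close> and \<open>e^{-\<Phi>}\<close> has the phase of \<open>Q\<close>.\<close>
  define C D where "C = P w0 * exp (- \<Phi> w0)" and "D = Q w0 * exp (\<Phi> w0)"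
  have "- \<i> * (P w * exp (- \<Phi> w)) = - \<i> * (P w0 * exp (- \<Phi> w0))" if "w \<in> M" for w
  proof (rule holomorphic_real_valued_constant[OF M(1,2) _ _ that w0])
    show "(\<lambda>w. - \<i> * (P w * exp (- \<Phi> w))) holomorphic_on M"
      using hol hol\<Phi> by (intro holomorphic_intros)
    fix z assume z: "z \<in> M"
    then obtain a where a: "P z = \<i> * of_real a * exp (- \<i> * of_real (\<theta> z))"
      using phase by (auto simp: P_def h_def)
    have "- \<i> * (P z * exp (- \<Phi> z)) = of_real (a / exp (Re (\<Phi> z)))"
      unfolding exp_minus exp\<Phi>[OF z] a by (simp add: field_simps del: exp_of_real)
    then show "Im (- \<i> * (P z * exp (- \<Phi> z))) = 0" by simp
  qed
  then have P: "P w = C * exp (\<Phi> w)" if "w \<in> M" for w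
    using that unfolding C_def by (simp add: exp_minus field_simps)
  have "Q w * exp (\<Phi> w) = Q w0 * exp (\<Phi> w0)" if "w \<in> M" for w
  proof (rule holomorphic_real_valued_constant[OF M(1,2) _ _ that w0])
    show "(\<lambda>w. Q w * exp (\<Phi> w)) holomorphic_on M"
      using hol hol\<Phi> by (intro holomorphic_intros)
    fix z assume z: "z \<in> M"
    then obtain b where b: "Q z = of_real b * exp (\<i> * of_real (\<theta> z))"
      using phase by (auto simp: Q_def h_def)
    have "Q z * exp (\<Phi> z) = of_real (b * exp (Re (\<Phi> z)))"
      unfolding exp\<Phi>[OF z] b by (simp add: exp_minus field_simps del: exp_of_real)
    then show "Im (Q z * exp (\<Phi> z)) = 0" by simp
  qed
  then have Q: "Q w = D * exp (- \<Phi> w)" if "w \<in> M" for w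
    using that unfolding D_def by (simp add: exp_minus field_simps)
  have CD: "C \<noteq> 0" "D \<noteq> 0"
    using phase[OF w0] unfolding C_def D_def P_def Q_def h_def by auto
  \<comment> \<open>\<open>S\<close> is constant since \<open>(P + Q)' = (P + Q) (P - Q)\<close> and \<open>h' = (P - Q) h\<close>.\<close>
  define S where "S w = (P w + Q w) / h w" for w
  have S: "S w = S w0" if "w \<in> M" for w
  proof (rule zero_derivative_constant[OF M(1,2) _ that w0])
    fix z assume z: "z \<in> M"
    have dh: "(h has_field_derivative (P z - Q z) * h z) (at z)"
    proof -
      have "(P z - Q z) * h z = deriv x z - deriv y z"
        using h[OF z] by (simp add: P_def Q_def left_diff_distrib)
      then show ?thesis
        using DERIV_diff[OF holomorphic_derivI[OF x M(1) z] holomorphic_derivI[OF y M(1) z]]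
        by (simp add: h_def[abs_def])
    qed
    note [derivative_intros] = \<Phi>[OF z] dh
    have "((\<lambda>w. (C * exp (\<Phi> w) + D * exp (- \<Phi> w)) / h w) has_field_derivative 0) (at z)"
      using h[OF z] P[OF z] Q[OF z]
      by (auto intro!: derivative_eq_intros simp: field_simps)
    then have "(S has_field_derivative 0) (at z)"
      by (rule has_field_derivative_transform_within_open[OF _ M(1) z]) (simp add: S_def P Q)
    then show "(S has_derivative (\<lambda>h. 0)) (at z)" by (simp add: has_field_derivative_def lambda_zero)
  qed
  have S0: "S w0 \<noteq> 0"
  proof
    assume "S w0 = 0"
    then have dw0: "dw \<theta> w = 0" if "w \<in> M" for w
      using S[OF that] h[OF that] h[OF w0] PQ[OF that] by (auto simp: S_def)
    have "\<theta> w = \<theta> w0" if "w \<in> M" for w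
    proof (rule zero_derivative_constant[OF M(1,2) _ that w0])
      fix z assume z: "z \<in> M"
      have "du \<theta> z = 0" "dv \<theta> z = 0" using dw0[OF z] by (auto simp: dw_def complex_eq_iff)
      then show "(\<theta> has_derivative (\<lambda>h. 0)) (at z)"
        using has_derivative_du_dv[OF \<theta>(1)[OF z]] by simp
    qed
    then show False using \<theta>(2) by (auto simp: constant_on_def)
  qed
  \<comment> \<open>\<open>P / Q = (C / D) e^{2 \<Phi>}\<close> and \<open>P Q = C D\<close> dictate \<open>k\<close> and \<open>c\<close>.\<close>
  define \<Psi> where "\<Psi> w = of_real (\<theta> w0) + 2 * (\<Phi> w - \<Phi> w0)" for w
  define k where "k = C / D * exp (2 * \<Phi> w0 - of_real (\<theta> w0))"
  define c where "c = S w0 / (C * D)"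
  show ?thesis
  proof (rule exI[of _ k], rule exI[of _ c], rule exI[of _ \<Psi>], intro conjI ballI)
    show kc: "k \<noteq> 0" "c \<noteq> 0" using CD S0 by (auto simp: k_def c_def)
    show "\<Psi> w0 = of_real (\<theta> w0)" by (simp add: \<Psi>_def)
    fix w assume w: "w \<in> M"
    show "(\<Psi> has_field_derivative - 4 * \<i> * dw \<theta> w) (at w)"
      unfolding \<Psi>_def using PQ[OF w] by (auto intro!: derivative_eq_intros \<Phi>[OF w])
    have ratio: "k * exp (\<Psi> w) * Q w = P w"
    proof -
      have "k * exp (\<Psi> w) = C / D * exp (2 * \<Phi> w0 - of_real (\<theta> w0) + \<Psi> w)"
        by (simp add: k_def exp_add)
      also have "2 * \<Phi> w0 - of_real (\<theta> w0) + \<Psi> w = \<Phi> w + \<Phi> w" by (simp add: \<Psi>_def)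
      finally have "k * exp (\<Psi> w) = C / D * (exp (\<Phi> w) * exp (\<Phi> w))" unfolding exp_add .
      then show ?thesis using CD by (simp add: P[OF w] Q[OF w] exp_minus)
    qed
    have nz: "P w \<noteq> 0" "Q w \<noteq> 0" using CD by (simp_all add: P[OF w] Q[OF w])
    have c: "c * (P w * Q w) * h w = P w + Q w"
    proof -
      have "P w * Q w = C * D" by (simp add: P[OF w] Q[OF w] exp_minus)
      then have "c * (P w * Q w) * h w = S w * h w" using CD S[OF w] by (simp add: c_def)
      then show ?thesis using h[OF w] by (simp add: S_def)
    qed
    have kE: "k * exp (\<Psi> w) = P w / Q w" using ratio nz by (simp add: field_simps)
    have dx: "deriv x w = P w * h w" and dy: "deriv y w = Q w * h w"
      using h[OF w] by (simp_all add: P_def Q_def)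
    have "c * deriv x w * Q w = P w + Q w" using c dx by (simp add: algebra_simps)
    then show "deriv x w = 1 / c * (1 + k * exp (\<Psi> w))"
      unfolding kE using nz kc by (simp add: field_simps)
    have "c * deriv y w * P w = P w + Q w" using c dy by (simp add: algebra_simps)
    moreover have "exp (- \<Psi> w) * P w = k * Q w"
      using ratio[symmetric] by (simp add: exp_minus)
    ultimately have "(c * k * deriv y w) * P w = (k + exp (- \<Psi> w)) * P w"
      by algebra
    then have "c * k * deriv y w = k + exp (- \<Psi> w)" using nz by simp
    then show "deriv y w = 1 / (c * k) * (k + exp (- \<Psi> w))"
      using kc by (simp add: field_simps)
  qed
qed

theorem theorem7p7:
  fixes M :: "complex set"
    and f \<nu> :: "complex \<Rightarrow> real ^ 4"
    and x y \<mu> :: "complex \<Rightarrow> complex"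
    and \<alpha> \<beta> \<theta> :: "complex \<Rightarrow> real"
    and w0 :: complex
  assumes "isotropic_surface M f"
    and "gauss_map M f \<nu>"
    and "\<not> \<nu> constant_on M"
    and "minimal_surface M f \<nu>"
    and "standing_representation M f \<nu> x y \<mu> \<alpha> \<beta>"
    and "\<forall>w\<in>M. cvec (f w) =
           (1/2) *s (\<mu> w *s W (x w) (y w) + cnj (\<mu> w) *s cnj_vec (W (x w) (y w)))"
    and "\<forall>w\<in>M. \<mu> w = exp (\<i> * of_real (\<theta> w)) / of_real (cmod (x w - y w))"
    and "harmonic_on M \<theta>"
    and "\<not> \<theta> constant_on M"
    and "x holomorphic_on M"
    and "y holomorphic_on M"
    and "w0 \<in> M"
  shows "\<exists>\<psi>. complex_harmonic_on M \<psi> \<and>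
           (\<forall>w\<in>M. \<forall>\<gamma>\<in>paths_in M w0 w.
              dw \<theta> contour_integrable_on \<gamma> \<and>
              \<psi> w = of_real (\<theta> w0) - 4 * \<i> * contour_integral \<gamma> (dw \<theta>)) \<and>
           (\<exists>k c. k \<noteq> 0 \<and> c \<noteq> 0 \<and>
             (\<forall>w\<in>M. \<forall>\<gamma>\<in>paths_in M w0 w.
                (\<lambda>\<xi>. 1 + k * exp (\<psi> \<xi>)) contour_integrable_on \<gamma> \<and>
                (\<lambda>\<xi>. k + exp (- \<psi> \<xi>)) contour_integrable_on \<gamma> \<and>
                x w = x w0 + 1 / c * contour_integral \<gamma> (\<lambda>\<xi>. 1 + k * exp (\<psi> \<xi>)) \<and>
                y w = y w0 + 1 / (c * k) * contour_integral \<gamma> (\<lambda>\<xi>. k + exp (- \<psi> \<xi>))))"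
proof -
  have M: "open M" "connected M" "simply_connected M"
    using assms(1) by (auto simp: isotropic_surface_def)
  have xy: "x w \<noteq> y w" if "w \<in> M" for w
    using assms(5) that by (auto simp: standing_representation_def)
  have \<theta>: "\<theta> differentiable (at w)" if "w \<in> M" for w
    using assms(8) that by (simp add: harmonic_on_def numeral_2_eq_2)
  note quotients = frame_quotients_on_surface[OF assms(1,5-7) \<theta> assms(10,11)]
  have "\<exists>k c \<Psi>. k \<noteq> 0 \<and> c \<noteq> 0 \<and> \<Psi> w0 = of_real (\<theta> w0) \<and>
      (\<forall>w\<in>M. (\<Psi> has_field_derivative - 4 * \<i> * dw \<theta> w) (at w) \<and>
         deriv x w = 1 / c * (1 + k * exp (\<Psi> w)) \<and>
         deriv y w = 1 / (c * k) * (k + exp (- \<Psi> w)))"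
    by (rule integrate_quotients[OF M assms(12,10,11) xy \<theta> assms(9) quotients])
  then obtain k c \<Psi> where kc: "k \<noteq> 0" "c \<noteq> 0" and \<Psi>0: "\<Psi> w0 = of_real (\<theta> w0)"
    and all: "\<forall>w\<in>M. (\<Psi> has_field_derivative - 4 * \<i> * dw \<theta> w) (at w) \<and>
         deriv x w = 1 / c * (1 + k * exp (\<Psi> w)) \<and>
         deriv y w = 1 / (c * k) * (k + exp (- \<Psi> w))"
    by (elim exE conjE)
  have d\<Psi>: "(\<Psi> has_field_derivative - 4 * \<i> * dw \<theta> w) (at w)"
    and dx: "deriv x w = 1 / c * (1 + k * exp (\<Psi> w))"
    and dy: "deriv y w = 1 / (c * k) * (k + exp (- \<Psi> w))" if "w \<in> M" for w
    using bspec[OF all that] by auto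
  have "\<Psi> holomorphic_on M"
    using holomorphic_on_open[OF M(1)] d\<Psi> by metis
  then have "complex_harmonic_on M \<Psi>"
    by (rule complex_harmonic_on_holomorphic[OF M(1)])
  moreover have "dw \<theta> contour_integrable_on \<gamma> \<and>
      \<Psi> w = of_real (\<theta> w0) - 4 * \<i> * contour_integral \<gamma> (dw \<theta>)"
    if \<gamma>: "\<gamma> \<in> paths_in M w0 w" for w \<gamma>
  proof -
    have "((\<lambda>w. \<i> / 4 * \<Psi> w) has_field_derivative dw \<theta> z) (at z)" if "z \<in> M" for z
      using DERIV_cmult[OF d\<Psi>[OF that], of "\<i> / 4"] by simp
    note i\<Psi> = contour_integral_primitive_eq[OF this \<gamma>]
    have "4 * \<i> * (\<i> / 4 * \<Psi> w - \<i> / 4 * \<Psi> w0) = \<Psi> w0 - \<Psi> w"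
      by (simp add: right_diff_distrib)
    then show ?thesis using i\<Psi> by (simp only: \<Psi>0) simp
  qed
  moreover have "(\<lambda>\<xi>. 1 + k * exp (\<Psi> \<xi>)) contour_integrable_on \<gamma> \<and>
      (\<lambda>\<xi>. k + exp (- \<Psi> \<xi>)) contour_integrable_on \<gamma> \<and>
      x w = x w0 + 1 / c * contour_integral \<gamma> (\<lambda>\<xi>. 1 + k * exp (\<Psi> \<xi>)) \<and>
      y w = y w0 + 1 / (c * k) * contour_integral \<gamma> (\<lambda>\<xi>. k + exp (- \<Psi> \<xi>))"
    if \<gamma>: "\<gamma> \<in> paths_in M w0 w" for w \<gamma>
  proof -
    have "((\<lambda>w. c * x w) has_field_derivative 1 + k * exp (\<Psi> z)) (at z)" if "z \<in> M" for z
      using DERIV_cmult[OF holomorphic_derivI[OF assms(10) M(1) that], of c] kc dx[OF that] by simp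
    note ix = contour_integral_primitive_eq[OF this \<gamma>]
    have "((\<lambda>w. c * k * y w) has_field_derivative k + exp (- \<Psi> z)) (at z)" if "z \<in> M" for z
      using DERIV_cmult[OF holomorphic_derivI[OF assms(11) M(1) that], of "c * k"] kc dy[OF that] by simp
    note iy = contour_integral_primitive_eq[OF this \<gamma>]
    show ?thesis using ix iy kc by (simp add: field_simps)
  qed
  ultimately show ?thesis using kc by blast
qed

end
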